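(* Let $k\ge 1$ and let $\Upsilon$ be a subset of $\mathcal{F}_{2,k}$. Then $$1+\sum_{n\ge 1}\frac{t^{2n}}{(2kn)!}\sum_{F\in\mathcal{F}^{(2),\Upsilon}_{2n,k}}x^{\Upsilon\text{-mch}^{(2)}(F)}=\frac{1}{1-\sum_{n\ge 1}\frac{(x-1)^{n-1}t^{2n}}{(2kn)!}\,full^{\Upsilon}_{2n}}.$$
   Context: $\mathcal{F}_{n,k}$ is the set of all fillings $F$ of the $k\times n$ rectangular array ($k$ rows, $n$ columns) with the integers $1,\dots,kn$, each used once, such that the elements in each column increase from bottom to top. For a filling of a $k\times n$ array by distinct positive integers with columns increasing from bottom to top, $\mathrm{red}(F)\in\mathcal{F}_{n,k}$ is obtained by replacing the $i$-th smallest entry by $i$. $F[i,i+1]$ is the $k\times 2$ filling formed by columns $i$ and $i+1$ of $F$. For $\Upsilon\subseteq\mathcal{F}_{2,k}$, $F\in\mathcal{F}_{n,k}$ has an $\Upsilon$-match starting at position $i$ ($1\le i\le n-1$) if $\mathrm{red}(F[i,i+1])\in\Upsilon$; $S^{\Upsilon}(F)$ is the set of all such $i$. $\mathcal{F}^{(2),\Upsilon}_{2n,k}$ is the set of $F\in\mathcal{F}_{2n,k}$ such that every odd number in $\{1,\dots,2n\}$ belongs to $S^{\Upsilon}(F)$. $\Upsilon\text{-mch}^{(2)}(F)$ is the number of $i$ such that $2i\in S^{\Upsilon}(F)$. $full^{\Upsilon}_n$ is the number of $F\in\mathcal{F}_{n,k}$ with $\Upsilon$-matches starting at every position $1,\dots,n-1$.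 The identity is one of formal power series in $t$ with coefficients in $\mathbb{Q}[x]$. *)

theory Defs
  imports "HOL-Computational_Algebra.Computational_Algebra" "HOL-Library.FuncSet"
begin

text \<open>Cell \<open>(r, c)\<close> lies in row \<open>r\<close>, counted from the bottom, and column \<open>c\<close>, counted from the left;
  both indices start at 1. Fillings are extensional functions, so that two fillings are equal iff
  they agree on the array.\<close>

definition cells :: "nat \<Rightarrow> nat \<Rightarrow> (nat \<times> nat) set" where
  "cells n k = {1..k} \<times> {1..n}"

definition fillings :: "nat \<Rightarrow> nat \<Rightarrow> (nat \<times> nat \<Rightarrow> nat) set" where
  "fillings n k = {F \<in> extensional (cells n k).
     bij_betw F (cells n k) {1..k * n} \<and>
     (\<forall>c\<in>{1..n}. strict_mono_on {1..k} (\<lambda>r. F (r, c)))}"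

text \<open>The entry of a cell is replaced by its rank among all entries of the array.\<close>

definition red :: "nat \<Rightarrow> nat \<Rightarrow> (nat \<times> nat \<Rightarrow> nat) \<Rightarrow> (nat \<times> nat \<Rightarrow> nat)" where
  "red n k F = (\<lambda>p\<in>cells n k. card {e \<in> F ` cells n k. e \<le> F p})"

definition column_pair :: "nat \<Rightarrow> (nat \<times> nat \<Rightarrow> nat) \<Rightarrow> nat \<Rightarrow> (nat \<times> nat \<Rightarrow> nat)" where
  "column_pair k F i = (\<lambda>(r, c)\<in>cells 2 k. F (r, if c = 1 then i else i + 1))"

definition match_set ::
    "nat \<Rightarrow> nat \<Rightarrow> (nat \<times> nat \<Rightarrow> nat) set \<Rightarrow> (nat \<times> nat \<Rightarrow> nat) \<Rightarrow> nat set" where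
  "match_set n k \<Upsilon> F = {i \<in> {1..n - 1}. red 2 k (column_pair k F i) \<in> \<Upsilon>}"

definition odd_match_fillings ::
    "nat \<Rightarrow> nat \<Rightarrow> (nat \<times> nat \<Rightarrow> nat) set \<Rightarrow> (nat \<times> nat \<Rightarrow> nat) set" where
  "odd_match_fillings n k \<Upsilon> =
     {F \<in> fillings n k. \<forall>i\<in>{1..n}. odd i \<longrightarrow> i \<in> match_set n k \<Upsilon> F}"

definition even_mch ::
    "nat \<Rightarrow> nat \<Rightarrow> (nat \<times> nat \<Rightarrow> nat) set \<Rightarrow> (nat \<times> nat \<Rightarrow> nat) \<Rightarrow> nat" where
  "even_mch n k \<Upsilon> F = card {i. 2 * i \<in> match_set n k \<Upsilon> F}"

definition full :: "nat \<Rightarrow> nat \<Rightarrow> (nat \<times> nat \<Rightarrow> nat) set \<Rightarrow> nat" where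
  "full n k \<Upsilon> = card {F \<in> fillings n k. \<forall>i\<in>{1..n - 1}. i \<in> match_set n k \<Upsilon> F}"

text \<open>The formal power series \<open>\<Sum>n\<ge>1. a n * t ^ (2 * n)\<close>; see \<open>even_series_sums\<close> below.\<close>

definition even_series :: "(nat \<Rightarrow> 'a) \<Rightarrow> 'a :: comm_ring_1 fps" where
  "even_series a = Abs_fps (\<lambda>m. if m > 0 \<and> even m then a (m div 2) else 0)"

lemma even_series_partial_sum_nth:
  fixes a :: "nat \<Rightarrow> 'a :: comm_ring_1"
  shows "(\<Sum>n<N. fps_const (a (Suc n)) * fps_X ^ (2 * Suc n)) $ m =
    (if m > 0 \<and> even m \<and> m \<le> 2 * N then a (m div 2) else 0)"
proof (induction N)
  case (Suc N)
  have "m = 2 * Suc N \<or> m = 2 * N + 1 \<or> m \<le> 2 * N \<or> m > 2 * Suc N"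
    by presburger
  then show ?case
    unfolding sum.lessThan_Suc fps_add_nth Suc fps_mult_left_const_nth fps_X_power_nth
    by (elim disjE) auto
qed auto

lemma even_series_sums:
  fixes a :: "nat \<Rightarrow> 'a :: comm_ring_1"
  shows "(\<lambda>n. fps_const (a (Suc n)) * fps_X ^ (2 * Suc n)) sums even_series a"
  unfolding sums_def
proof (rule tendsto_fpsI)
  fix m
  show "\<forall>\<^sub>F N in sequentially.
          (\<Sum>n<N. fps_const (a (Suc n)) * fps_X ^ (2 * Suc n)) $ m = even_series a $ m"
    using eventually_ge_at_top[of m]
    by eventually_elim (unfold even_series_partial_sum_nth, simp add: even_series_def)
qed

end

theory Submission
  imports Defs "HOL-Library.Infinite_Set"
begin

text \<open>
  Write \<open>A n\<close> for the sum of \<open>x ^ even_mch (2 * n) k \<Upsilon> F\<close> over the fillings \<open>F\<close> with \<open>2 * n\<close> columns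
  and matches at all odd positions. Substituting \<open>x = (x - 1) + 1\<close> turns \<open>A n\<close> into a sum over such
  fillings in which some of the even matches are marked, each mark having weight \<open>x - 1\<close>. Let \<open>2 * m\<close>
  be the first even position without a mark, where \<open>m = n\<close> if all even positions before the end are
  marked. The first \<open>2 * m\<close> columns match at every position and carry \<open>m - 1\<close> marks; the remaining
  \<open>2 * (n - m)\<close> columns form an arbitrary marked filling of the same kind, and between the two parts
  there is no condition. Distributing the \<open>2 * k * n\<close> entries over the two parts gives
  \<open>A n = (\<Sum>m = 1..n. (2 * k * n choose 2 * k * m) * full (2 * m) k \<Upsilon> * (x - 1) ^ (m - 1) * A (n - m))\<close>
  for \<open>n \<ge> 1\<close> (lemma \<open>odd_match_recurrence\<close>). Divided by \<open>(2 * k * n)!\<close>, this says that the product of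
  the series on the left and the denominator on the right is 1 (lemma \<open>even_series_reciprocal\<close>).

  Two facts carry the recurrence. Lemma \<open>sum_fillings_split\<close> cuts fillings between two columns: a
  filling is the same as a choice of the set of entries of the left part together with fillings of
  both parts by the chosen entries and by the others, and since matches depend only on relative
  order, each part may be replaced by a standard filling. Lemma \<open>odd_weight_expansion\<close> decomposes the
  weight of one filling by the first unmarked even position. Marks never appear explicitly there:
  summed over all markings of the right part, they give back a power of \<open>x\<close>.
\<close>

section \<open>Fillings with a prescribed set of entries\<close>

text \<open>The fillings of the array whose set of entries is \<open>V\<close> instead of an initial segment of the
  positive integers. This set is empty unless \<open>V\<close> has as many elements as the array has cells.\<close>

definition on_values :: "nat \<Rightarrow> nat \<Rightarrow> nat set \<Rightarrow> (nat \<times> nat \<Rightarrow> nat) set" where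
  "on_values n k V = {F \<in> extensional (cells n k).
     bij_betw F (cells n k) V \<and>
     (\<forall>c\<in>{1..n}. strict_mono_on {1..k} (\<lambda>r. F (r, c)))}"

lemma fillings_eq_on_values: "fillings n k = on_values n k {1..k * n}"
  by (simp add: fillings_def on_values_def)

lemma finite_cells [simp]: "finite (cells n k)"
  by (simp add: cells_def)

lemma card_cells: "card (cells n k) = k * n"
  by (simp add: cells_def card_cartesian_product)

lemma finite_on_values:
  assumes "finite V"
  shows "finite (on_values n k V)"
proof (rule finite_subset)
  show "on_values n k V \<subseteq> cells n k \<rightarrow>\<^sub>E V"
    by (auto simp: on_values_def PiE_def bij_betw_def)
  show "finite (cells n k \<rightarrow>\<^sub>E V)"
    using assms by (intro finite_PiE) auto
qed

text \<open>Standardization sees only the relative order of the entries, so it is unchanged when these are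
  relabelled by a strictly increasing map.\<close>

lemma red_strict_mono:
  assumes "strict_mono_on V \<phi>" "F ` cells n k \<subseteq> V"
    and "\<And>p. p \<in> cells n k \<Longrightarrow> G p = \<phi> (F p)"
  shows "red n k G = red n k F"
proof -
  have "card {e \<in> G ` cells n k. e \<le> G p} = card {e \<in> F ` cells n k. e \<le> F p}"
    if p: "p \<in> cells n k" for p
  proof -
    have "{e \<in> G ` cells n k. e \<le> G p} = \<phi> ` {e \<in> F ` cells n k. e \<le> F p}"
      using assms p strict_mono_on_less_eq[OF assms(1)] by (auto simp: image_iff subset_eq)
    moreover have "inj_on \<phi> {e \<in> F ` cells n k. e \<le> F p}"
      using strict_mono_on_imp_inj_on[OF assms(1)] assms(2) by (rule_tac inj_on_subset) auto
    ultimately show ?thesis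
      by (simp add: card_image)
  qed
  then show ?thesis
    unfolding red_def by (rule restrict_ext)
qed

lemma match_set_relabel:
  assumes "strict_mono_on V \<phi>" "F ` cells n k \<subseteq> V"
  shows "match_set n k \<Upsilon> (restrict (\<phi> \<circ> F) (cells n k)) = match_set n k \<Upsilon> F"
proof -
  have "red 2 k (column_pair k (restrict (\<phi> \<circ> F) (cells n k)) i) = red 2 k (column_pair k F i)"
    if "i \<in> {1..n - 1}" for i
    using assms(1)
  proof (rule red_strict_mono)
    have in_cells: "(r, if c = 1 then i else i + 1) \<in> cells n k" if "(r, c) \<in> cells 2 k" for r c
      using that \<open>i \<in> {1..n - 1}\<close> by (auto simp: cells_def)
    show "column_pair k F i ` cells 2 k \<subseteq> V"
      using in_cells assms(2) by (force simp: column_pair_def)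
    show "column_pair k (restrict (\<phi> \<circ> F) (cells n k)) i p = \<phi> (column_pair k F i p)"
      if "p \<in> cells 2 k" for p
      using that in_cells by (cases p) (auto simp: column_pair_def)
  qed
  then show ?thesis
    by (auto simp: match_set_def)
qed

lemma relabel_in_on_values:
  assumes "strict_mono_on V \<phi>" "bij_betw \<phi> V W" "F \<in> on_values n k V"
  shows "restrict (\<phi> \<circ> F) (cells n k) \<in> on_values n k W"
proof -
  have bij: "bij_betw F (cells n k) V"
    and mono: "\<And>c. c \<in> {1..n} \<Longrightarrow> strict_mono_on {1..k} (\<lambda>r. F (r, c))"
    using assms(3) by (auto simp: on_values_def)
  have "bij_betw (restrict (\<phi> \<circ> F) (cells n k)) (cells n k) W"
    using bij_betw_trans[OF bij assms(2)] by (subst bij_betw_restrict_eq)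
  moreover have "strict_mono_on {1..k} (\<lambda>r. restrict (\<phi> \<circ> F) (cells n k) (r, c))"
    if c: "c \<in> {1..n}" for c
  proof (rule strict_mono_onI)
    fix r s assume rs: "r \<in> {1..k}" "s \<in> {1..k}" "r < s"
    have cell: "(r, c) \<in> cells n k" "(s, c) \<in> cells n k"
      using rs c by (auto simp: cells_def)
    then have "F (r, c) \<in> V" "F (s, c) \<in> V"
      using bij by (auto simp: bij_betw_def)
    then have "\<phi> (F (r, c)) < \<phi> (F (s, c))"
      using strict_mono_onD[OF mono[OF c] rs] strict_mono_onD[OF assms(1)] by blast
    then show "restrict (\<phi> \<circ> F) (cells n k) (r, c) < restrict (\<phi> \<circ> F) (cells n k) (s, c)"
      using cell by simp
  qed
  ultimately show ?thesis
    by (auto simp: on_values_def)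
qed

lemma obtain_order_isomorphism:
  fixes V W :: "nat set"
  assumes "finite V" "finite W" "card V = card W"
  obtains \<phi> \<psi> where "bij_betw \<phi> V W" "strict_mono_on V \<phi>" "bij_betw \<psi> W V" "strict_mono_on W \<psi>"
    "\<And>v. v \<in> V \<Longrightarrow> \<psi> (\<phi> v) = v" "\<And>w. w \<in> W \<Longrightarrow> \<phi> (\<psi> w) = w"
proof -
  obtain g where g: "bij_betw g {..<card V} V" "strict_mono_on {..<card V} g"
    using ex_bij_betw_strict_mono_card[OF assms(1)] by blast
  obtain h where h: "bij_betw h {..<card V} W" "strict_mono_on {..<card V} h"
    using ex_bij_betw_strict_mono_card[OF assms(2)] assms(3) by metis
  have transfer: "bij_betw (q \<circ> inv_into {..<card V} p) A B"
    "strict_mono_on A (q \<circ> inv_into {..<card V} p)"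
    if p: "bij_betw p {..<card V} A" "strict_mono_on {..<card V} p"
      and q: "bij_betw q {..<card V} B" "strict_mono_on {..<card V} q" for p q and A B :: "nat set"
  proof -
    have inv: "bij_betw (inv_into {..<card V} p) A {..<card V}"
      using p(1) by (rule bij_betw_inv_into)
    show "bij_betw (q \<circ> inv_into {..<card V} p) A B"
      using inv q(1) by (rule bij_betw_trans)
    show "strict_mono_on A (q \<circ> inv_into {..<card V} p)"
    proof (rule strict_mono_onI)
      fix r s assume rs: "r \<in> A" "s \<in> A" "r < s"
      let ?r = "inv_into {..<card V} p r" and ?s = "inv_into {..<card V} p s"
      have "?r \<in> {..<card V}" "?s \<in> {..<card V}"
        using inv rs by (auto dest: bij_betwE)
      moreover have "p ?r = r" "p ?s = s"
        using p(1) rs by (auto simp: bij_betw_inv_into_right)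
      ultimately show "(q \<circ> inv_into {..<card V} p) r < (q \<circ> inv_into {..<card V} p) s"
        using rs strict_mono_on_less[OF p(2)] strict_mono_on_less[OF q(2)] by (metis comp_apply)
    qed
  qed
  have "inv_into {..<card V} p (p i) = i" if "bij_betw p {..<card V} A" "i < card V"
    for p i and A :: "nat set"
    using that by (simp add: bij_betw_inv_into_left)
  moreover have "p (inv_into {..<card V} p a) = a \<and> inv_into {..<card V} p a < card V"
    if "bij_betw p {..<card V} A" "a \<in> A" for p a and A :: "nat set"
    using that bij_betwE[OF bij_betw_inv_into[OF that(1)]] by (auto simp: bij_betw_inv_into_right)
  ultimately show thesis
    using g h
    by (intro that[OF transfer[OF g h] transfer[OF h g]]) auto
qed

text \<open>A sum over fillings whose terms depend only on the match set is the same for all sets of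
  entries of a given size: the order isomorphism between two such sets relabels the fillings.\<close>

lemma sum_on_values_cong_card:
  fixes f :: "nat set \<Rightarrow> 'b :: comm_monoid_add"
  assumes "finite V" "finite W" "card V = card W"
  shows "(\<Sum>F\<in>on_values n k V. f (match_set n k \<Upsilon> F)) =
    (\<Sum>F\<in>on_values n k W. f (match_set n k \<Upsilon> F))"
proof -
  obtain \<phi> \<psi> where \<phi>: "bij_betw \<phi> V W" "strict_mono_on V \<phi>"
    and \<psi>: "bij_betw \<psi> W V" "strict_mono_on W \<psi>"
    and inv: "\<And>v. v \<in> V \<Longrightarrow> \<psi> (\<phi> v) = v" "\<And>w. w \<in> W \<Longrightarrow> \<phi> (\<psi> w) = w"
    using obtain_order_isomorphism[OF assms] by blast
  have ext: "F \<in> extensional (cells n k)" and im: "F ` cells n k = A"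
    if "F \<in> on_values n k A" for F A
    using that by (auto simp: on_values_def bij_betw_def)
  show ?thesis
  proof (rule sum.reindex_bij_witness[where
        i = "\<lambda>F. restrict (\<psi> \<circ> F) (cells n k)" and j = "\<lambda>F. restrict (\<phi> \<circ> F) (cells n k)"])
    fix F assume F: "F \<in> on_values n k V"
    show "restrict (\<psi> \<circ> restrict (\<phi> \<circ> F) (cells n k)) (cells n k) = F"
      using ext[OF F] im[OF F] inv by (intro extensionalityI[OF _ ext[OF F]]) auto
    show "restrict (\<phi> \<circ> F) (cells n k) \<in> on_values n k W"
      using \<phi> F by (intro relabel_in_on_values)
    show "f (match_set n k \<Upsilon> (restrict (\<phi> \<circ> F) (cells n k))) = f (match_set n k \<Upsilon> F)"
      using match_set_relabel[OF \<phi>(2)] im[OF F] by simp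
  next
    fix F assume F: "F \<in> on_values n k W"
    show "restrict (\<phi> \<circ> restrict (\<psi> \<circ> F) (cells n k)) (cells n k) = F"
      using ext[OF F] im[OF F] inv by (intro extensionalityI[OF _ ext[OF F]]) auto
    show "restrict (\<psi> \<circ> F) (cells n k) \<in> on_values n k V"
      using \<psi> F by (intro relabel_in_on_values)
  qed
qed

section \<open>Cutting a filling between two columns\<close>

text \<open>The first \<open>a\<close> columns of a filling.\<close>

definition left_part :: "nat \<Rightarrow> nat \<Rightarrow> (nat \<times> nat \<Rightarrow> nat) \<Rightarrow> (nat \<times> nat \<Rightarrow> nat)" where
  "left_part a k F = restrict F (cells a k)"

text \<open>The \<open>b\<close> columns after the first \<open>a\<close>, renumbered to start at 1.\<close>

definition right_part :: "nat \<Rightarrow> nat \<Rightarrow> nat \<Rightarrow> (nat \<times> nat \<Rightarrow> nat) \<Rightarrow> (nat \<times> nat \<Rightarrow> nat)" where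
  "right_part a b k F = (\<lambda>(r, c)\<in>cells b k. F (r, a + c))"

text \<open>The filling with left part \<open>G\<close> of \<open>a\<close> columns and right part \<open>H\<close> of \<open>b\<close> columns.\<close>

definition join_parts ::
    "nat \<Rightarrow> nat \<Rightarrow> nat \<Rightarrow> (nat \<times> nat \<Rightarrow> nat) \<Rightarrow> (nat \<times> nat \<Rightarrow> nat) \<Rightarrow> (nat \<times> nat \<Rightarrow> nat)" where
  "join_parts a b k G H = (\<lambda>(r, c)\<in>cells (a + b) k. if c \<le> a then G (r, c) else H (r, c - a))"

lemma column_pair_cong:
  assumes "\<And>r. r \<in> {1..k} \<Longrightarrow> F (r, i) = G (r, j)"
    and "\<And>r. r \<in> {1..k} \<Longrightarrow> F (r, i + 1) = G (r, j + 1)"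
  shows "column_pair k F i = column_pair k G j"
  unfolding column_pair_def using assms by (intro restrict_ext) (auto simp: cells_def)

lemma match_set_left_part:
  "match_set a k \<Upsilon> (left_part a k F) = match_set (a + b) k \<Upsilon> F \<inter> {1..a - 1}"
proof -
  have "column_pair k (left_part a k F) i = column_pair k F i" if "i \<in> {1..a - 1}" for i
    using that by (intro column_pair_cong) (auto simp: left_part_def cells_def)
  then show ?thesis
    by (auto simp: match_set_def)
qed

lemma match_set_right_part:
  "match_set b k \<Upsilon> (right_part a b k F) = {i \<in> {1..b - 1}. a + i \<in> match_set (a + b) k \<Upsilon> F}"
proof -
  have "column_pair k (right_part a b k F) i = column_pair k F (a + i)" if "i \<in> {1..b - 1}" for i
    using that by (intro column_pair_cong) (auto simp: right_part_def cells_def)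
  then show ?thesis
    by (auto simp: match_set_def)
qed

lemma shifted_cells: "(\<lambda>(r, c). (r, a + c)) ` cells b k = cells (a + b) k - cells a k"
proof -
  have "(r, c) \<in> (\<lambda>(r, c). (r, a + c)) ` cells b k" if "(r, c) \<in> cells (a + b) k - cells a k" for r c
    using that by (intro image_eqI[of _ _ "(r, c - a)"]) (auto simp: cells_def)
  then have "cells (a + b) k - cells a k \<subseteq> (\<lambda>(r, c). (r, a + c)) ` cells b k"
    by (rule subrelI)
  moreover have "(\<lambda>(r, c). (r, a + c)) ` cells b k \<subseteq> cells (a + b) k - cells a k"
    by (auto simp: cells_def)
  ultimately show ?thesis
    by (rule equalityI[rotated])
qed

lemma parts_in_on_values:
  assumes F: "F \<in> on_values (a + b) k W" and V: "V = F ` cells a k"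
  shows "V \<subseteq> W" "card V = k * a" "left_part a k F \<in> on_values a k V"
    "right_part a b k F \<in> on_values b k (W - V)"
proof -
  have bij: "bij_betw F (cells (a + b) k) W"
    and mono: "\<And>c. c \<in> {1..a + b} \<Longrightarrow> strict_mono_on {1..k} (\<lambda>r. F (r, c))"
    using F by (auto simp: on_values_def)
  have sub: "cells a k \<subseteq> cells (a + b) k"
    by (auto simp: cells_def)
  have left: "bij_betw F (cells a k) V"
    using bij_betw_subset[OF bij sub] V by blast
  show "V \<subseteq> W"
    using bij sub V by (auto simp: bij_betw_def)
  show "card V = k * a"
    using bij_betw_same_card[OF left] by (simp add: card_cells)
  have "bij_betw (left_part a k F) (cells a k) V"
    unfolding left_part_def using left by (subst bij_betw_restrict_eq)
  moreover have "strict_mono_on {1..k} (\<lambda>r. left_part a k F (r, c))" if "c \<in> {1..a}" for c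
    using mono[of c] that by (auto simp: left_part_def cells_def strict_mono_on_def)
  ultimately show "left_part a k F \<in> on_values a k V"
    by (auto simp: on_values_def left_part_def)
  have "bij_betw F (cells (a + b) k - cells a k) (W - V)"
    using bij left sub \<open>V \<subseteq> W\<close> by (rule bij_betw_DiffI)
  moreover have "bij_betw (\<lambda>(r, c). (r, a + c)) (cells b k) (cells (a + b) k - cells a k)"
    by (auto simp: bij_betw_def shifted_cells inj_on_def)
  ultimately have "bij_betw (F \<circ> (\<lambda>(r, c). (r, a + c))) (cells b k) (W - V)"
    by (rule bij_betw_trans[rotated])
  moreover have "F \<circ> (\<lambda>(r, c). (r, a + c)) = (\<lambda>(r, c). F (r, a + c))"
    by auto
  ultimately have "bij_betw (right_part a b k F) (cells b k) (W - V)"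
    unfolding right_part_def by (subst bij_betw_restrict_eq) simp
  moreover have "strict_mono_on {1..k} (\<lambda>r. right_part a b k F (r, c))" if "c \<in> {1..b}" for c
    using mono[of "a + c"] that by (auto simp: right_part_def cells_def strict_mono_on_def)
  ultimately show "right_part a b k F \<in> on_values b k (W - V)"
    by (auto simp: on_values_def right_part_def)
qed

lemma parts_join_parts:
  assumes "G \<in> extensional (cells a k)" "H \<in> extensional (cells b k)"
  shows "left_part a k (join_parts a b k G H) = G" "right_part a b k (join_parts a b k G H) = H"
proof -
  show "left_part a k (join_parts a b k G H) = G"
    by (rule extensionalityI[OF _ assms(1)]) (auto simp: left_part_def join_parts_def cells_def)
  show "right_part a b k (join_parts a b k G H) = H"
    by (rule extensionalityI[OF _ assms(2)]) (auto simp: right_part_def join_parts_def cells_def)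
qed

lemma join_parts_parts:
  assumes "F \<in> extensional (cells (a + b) k)"
  shows "join_parts a b k (left_part a k F) (right_part a b k F) = F"
  by (rule extensionalityI[OF _ assms])
    (auto simp: left_part_def right_part_def join_parts_def cells_def)

lemma join_parts_in_on_values:
  assumes V: "V \<subseteq> W" and G: "G \<in> on_values a k V" and H: "H \<in> on_values b k (W - V)"
  shows "join_parts a b k G H \<in> on_values (a + b) k W" "join_parts a b k G H ` cells a k = V"
proof -
  let ?F = "join_parts a b k G H"
  have ext: "G \<in> extensional (cells a k)" "H \<in> extensional (cells b k)"
    and bij: "bij_betw G (cells a k) V" "bij_betw H (cells b k) (W - V)"
    and mono: "\<And>c. c \<in> {1..a} \<Longrightarrow> strict_mono_on {1..k} (\<lambda>r. G (r, c))"
      "\<And>c. c \<in> {1..b} \<Longrightarrow> strict_mono_on {1..k} (\<lambda>r. H (r, c))"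
    using G H by (auto simp: on_values_def)
  have left: "bij_betw ?F (cells a k) V"
    using bij(1) by (rule bij_betw_cong[THEN iffD1, rotated]) (auto simp: join_parts_def cells_def)
  then show "?F ` cells a k = V"
    by (simp add: bij_betw_def)
  have shift: "bij_betw (\<lambda>(r, c). (r, a + c)) (cells b k) (cells (a + b) k - cells a k)"
    by (auto simp: bij_betw_def shifted_cells inj_on_def)
  have "bij_betw (?F \<circ> (\<lambda>(r, c). (r, a + c))) (cells b k) (W - V)"
    using bij(2) by (rule bij_betw_cong[THEN iffD1, rotated]) (auto simp: join_parts_def cells_def)
  then have "bij_betw ?F (cells (a + b) k - cells a k) (W - V)"
    using bij_betw_comp_iff[OF shift] by blast
  then have "bij_betw ?F (cells a k \<union> (cells (a + b) k - cells a k)) (V \<union> (W - V))"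
    using left by (intro bij_betw_combine) auto
  moreover have "cells a k \<union> (cells (a + b) k - cells a k) = cells (a + b) k"
    by (auto simp: cells_def)
  ultimately have "bij_betw ?F (cells (a + b) k) W"
    using V by (simp add: Un_absorb1)
  moreover have "strict_mono_on {1..k} (\<lambda>r. ?F (r, c))" if c: "c \<in> {1..a + b}" for c
  proof (cases "c \<le> a")
    case True
    then show ?thesis
      using mono(1)[of c] c by (auto simp: join_parts_def cells_def strict_mono_on_def)
  next
    case False
    then have "c - a \<in> {1..b}"
      using c by auto
    from mono(2)[OF this] show ?thesis
      using False c by (auto simp: join_parts_def cells_def strict_mono_on_def)
  qed
  ultimately show "?F \<in> on_values (a + b) k W"
    by (auto simp: on_values_def join_parts_def)
qed

text \<open>The left and right parts of a filling of \<open>a + b\<close> columns vary independently, up to the choice of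
  the \<open>k * a\<close> entries on the left. Position \<open>a\<close>, which compares the last column of the left part with
  the first column of the right part, belongs to neither of the two match sets, so that a weight of
  product form places no condition on it.\<close>

lemma sum_fillings_split:
  fixes f g :: "nat set \<Rightarrow> 'b :: comm_semiring_1"
  shows "(\<Sum>F\<in>fillings (a + b) k. f (match_set (a + b) k \<Upsilon> F \<inter> {1..a - 1}) *
            g {i \<in> {1..b - 1}. a + i \<in> match_set (a + b) k \<Upsilon> F}) =
         of_nat ((k * (a + b)) choose (k * a)) *
           ((\<Sum>G\<in>fillings a k. f (match_set a k \<Upsilon> G)) *
            (\<Sum>H\<in>fillings b k. g (match_set b k \<Upsilon> H)))"
proof -
  define W where "W = {1..k * (a + b)}"
  define Vs where "Vs = {V. V \<subseteq> W \<and> card V = k * a}"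
  define P where "P V = on_values a k V \<times> on_values b k (W - V)" for V
  have fin: "finite V" "finite (W - V)" if "V \<in> Vs" for V
    using that finite_subset[of V W] by (auto simp: Vs_def W_def)
  have finVs: "finite Vs"
    unfolding Vs_def by (rule finite_subset[of _ "Pow W"]) (auto simp: W_def)
  have ext: "F \<in> extensional (cells n k)" if "F \<in> on_values n k V" for F n V
    using that by (simp add: on_values_def)
  have "(\<Sum>F\<in>on_values (a + b) k W. f (match_set (a + b) k \<Upsilon> F \<inter> {1..a - 1}) *
            g {i \<in> {1..b - 1}. a + i \<in> match_set (a + b) k \<Upsilon> F}) =
        (\<Sum>(V, G, H)\<in>Sigma Vs P. f (match_set a k \<Upsilon> G) * g (match_set b k \<Upsilon> H))"
  proof (rule sum.reindex_bij_witness[where i = "\<lambda>(V, G, H). join_parts a b k G H"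
        and j = "\<lambda>F. (F ` cells a k, left_part a k F, right_part a b k F)"])
    fix F assume F: "F \<in> on_values (a + b) k W"
    show "(case (F ` cells a k, left_part a k F, right_part a b k F) of
        (V, G, H) \<Rightarrow> join_parts a b k G H) = F"
      using join_parts_parts[OF ext[OF F]] by simp
    show "(F ` cells a k, left_part a k F, right_part a b k F) \<in> Sigma Vs P"
      using parts_in_on_values[OF F refl] by (simp add: Vs_def P_def)
    show "(case (F ` cells a k, left_part a k F, right_part a b k F) of
        (V, G, H) \<Rightarrow> f (match_set a k \<Upsilon> G) * g (match_set b k \<Upsilon> H)) =
      f (match_set (a + b) k \<Upsilon> F \<inter> {1..a - 1}) *
        g {i \<in> {1..b - 1}. a + i \<in> match_set (a + b) k \<Upsilon> F}"
      by (simp add: match_set_left_part[of _ _ _ _ b] match_set_right_part)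
  next
    fix x assume "x \<in> Sigma Vs P"
    then obtain V G H where x: "x = (V, G, H)" and V: "V \<subseteq> W"
      and G: "G \<in> on_values a k V" and H: "H \<in> on_values b k (W - V)"
      by (auto simp: Vs_def P_def)
    show "(case x of (V, G, H) \<Rightarrow> join_parts a b k G H) \<in> on_values (a + b) k W"
      using join_parts_in_on_values(1)[OF V G H] by (simp add: x)
    show "((case x of (V, G, H) \<Rightarrow> join_parts a b k G H) ` cells a k,
        left_part a k (case x of (V, G, H) \<Rightarrow> join_parts a b k G H),
        right_part a b k (case x of (V, G, H) \<Rightarrow> join_parts a b k G H)) = x"
      using join_parts_in_on_values(2)[OF V G H] parts_join_parts[OF ext[OF G] ext[OF H]]
      by (simp add: x)
  qed
  also have "\<dots> = (\<Sum>V\<in>Vs. \<Sum>(G, H)\<in>P V. f (match_set a k \<Upsilon> G) * g (match_set b k \<Upsilon> H))"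
    using fin by (intro sum.Sigma[symmetric] finVs) (simp add: P_def finite_on_values)
  also have "\<dots> = (\<Sum>V\<in>Vs. (\<Sum>G\<in>on_values a k V. f (match_set a k \<Upsilon> G)) *
      (\<Sum>H\<in>on_values b k (W - V). g (match_set b k \<Upsilon> H)))"
    unfolding P_def sum_product sum.cartesian_product ..
  also have "\<dots> = (\<Sum>V\<in>Vs. (\<Sum>G\<in>fillings a k. f (match_set a k \<Upsilon> G)) *
      (\<Sum>H\<in>fillings b k. g (match_set b k \<Upsilon> H)))"
  proof (rule sum.cong[OF refl])
    fix V assume V: "V \<in> Vs"
    have "(\<Sum>G\<in>on_values a k V. f (match_set a k \<Upsilon> G)) =
        (\<Sum>G\<in>fillings a k. f (match_set a k \<Upsilon> G))"
      unfolding fillings_eq_on_values using V fin(1)[OF V]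
      by (intro sum_on_values_cong_card) (simp_all add: Vs_def)
    moreover have "card (W - V) = k * b"
      using V fin(1)[OF V] by (simp add: card_Diff_subset Vs_def W_def distrib_left)
    then have "(\<Sum>H\<in>on_values b k (W - V). g (match_set b k \<Upsilon> H)) =
        (\<Sum>H\<in>fillings b k. g (match_set b k \<Upsilon> H))"
      unfolding fillings_eq_on_values using fin(2)[OF V] by (intro sum_on_values_cong_card) auto
    ultimately show "(\<Sum>G\<in>on_values a k V. f (match_set a k \<Upsilon> G)) *
        (\<Sum>H\<in>on_values b k (W - V). g (match_set b k \<Upsilon> H)) =
      (\<Sum>G\<in>fillings a k. f (match_set a k \<Upsilon> G)) * (\<Sum>H\<in>fillings b k. g (match_set b k \<Upsilon> H))"
      by (rule arg_cong2)
  qed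
  also have "\<dots> = of_nat (card Vs) * ((\<Sum>G\<in>fillings a k. f (match_set a k \<Upsilon> G)) *
      (\<Sum>H\<in>fillings b k. g (match_set b k \<Upsilon> H)))"
    by (rule sum_constant)
  also have "card Vs = (k * (a + b)) choose (k * a)"
    unfolding Vs_def by (simp add: n_subsets W_def)
  finally show ?thesis
    unfolding fillings_eq_on_values[of "a + b"] W_def .
qed

section \<open>Expansion by the first unmarked even position\<close>

text \<open>Here \<open>S\<close> stands for the set of halves of the even matches. The \<open>m\<close>-th term collects the subsets of
  \<open>S\<close>, weighted by \<open>x - 1\<close> to the number of their elements, whose smallest missing positive integer
  is \<open>m\<close>; those elements of \<open>S\<close> that exceed \<open>m\<close> may be in the subset or not and contribute a factor
  \<open>(x - 1) + 1\<close> each.\<close>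

lemma power_card_expansion:
  fixes x :: "'b :: comm_ring_1"
  assumes "S \<subseteq> {1..<n}" "n \<ge> 1"
  shows "x ^ card S = (\<Sum>m = 1..n. (if {1..<m} \<subseteq> S
    then (x - 1) ^ (m - 1) * x ^ card {i. i \<ge> 1 \<and> m + i \<in> S} else 0))"
proof -
  \<comment> \<open>\<open>T m\<close> collects the terms from \<open>m\<close> on, i.e. the subsets that contain \<open>{1..<m}\<close>, so the sum
    telescopes; \<open>T (n + 1)\<close> vanishes because \<open>n \<notin> S\<close>.\<close>
  define T where "T m = (if {1..<m} \<subseteq> S then (x - 1) ^ (m - 1) * x ^ card (S \<inter> {m..}) else 0)" for m
  have fin: "finite S"
    using assms(1) finite_subset by blast
  have step: "T m - T (Suc m) = (if {1..<m} \<subseteq> S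
    then (x - 1) ^ (m - 1) * x ^ card {i. i \<ge> 1 \<and> m + i \<in> S} else 0)" if "m \<in> {1..n}" for m
  proof -
    have image: "(+) m ` {i. i \<ge> 1 \<and> m + i \<in> S} = S \<inter> {Suc m..}"
    proof (intro equalityI subsetI)
      fix j assume "j \<in> S \<inter> {Suc m..}"
      then show "j \<in> (+) m ` {i. i \<ge> 1 \<and> m + i \<in> S}"
        by (intro image_eqI[of _ _ "j - m"]) auto
    qed auto
    have shift: "card {i. i \<ge> 1 \<and> m + i \<in> S} = card (S \<inter> {Suc m..})"
      using card_image[OF inj_on_add[of m "{i. i \<ge> 1 \<and> m + i \<in> S}"]] unfolding image by (rule sym)
    have range: "{1..<Suc m} \<subseteq> S \<longleftrightarrow> {1..<m} \<subseteq> S \<and> m \<in> S"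
      using that by (auto simp: less_Suc_eq)
    show ?thesis
    proof (cases "m \<in> S")
      case True
      then have "S \<inter> {m..} = insert m (S \<inter> {Suc m..})"
        by (auto simp: Suc_le_eq)
      then have "card (S \<inter> {m..}) = Suc (card (S \<inter> {Suc m..}))"
        using fin by simp
      moreover obtain l where "m = Suc l"
        using \<open>m \<in> {1..n}\<close> by (cases m) auto
      ultimately show ?thesis
        unfolding T_def shift using True range by (simp add: algebra_simps)
    next
      case False
      then have "S \<inter> {m..} = S \<inter> {Suc m..}"
        using atLeast_Suc[of m] by auto
      then show ?thesis
        unfolding T_def shift using False range by simp
    qed
  qed
  have "n \<in> {1..<Suc n}" "n \<notin> S" "S \<inter> {1..} = S"
    using assms by auto
  then have "T (Suc n) = 0" "T 1 = x ^ card S"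
    unfolding T_def by auto
  moreover have "(\<Sum>m = 1..n. T m - T (Suc m)) = T 1 - T (Suc n)"
    using sum_Suc_diff[of 1 n "\<lambda>m. - T m"] assms(2) by (simp add: algebra_simps)
  ultimately have "x ^ card S = (\<Sum>m = 1..n. T m - T (Suc m))"
    by simp
  also have "\<dots> = (\<Sum>m = 1..n. (if {1..<m} \<subseteq> S
      then (x - 1) ^ (m - 1) * x ^ card {i. i \<ge> 1 \<and> m + i \<in> S} else 0))"
    by (rule sum.cong[OF refl step])
  finally show ?thesis .
qed

text \<open>The weight, as a function of the match set \<open>M\<close>, that a filling of \<open>2 * n\<close> columns contributes to the
  sum of \<open>x ^ even_mch (2 * n) k \<Upsilon> F\<close> over \<open>odd_match_fillings (2 * n) k \<Upsilon>\<close>.\<close>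

definition odd_weight :: "'b \<Rightarrow> nat \<Rightarrow> nat set \<Rightarrow> 'b :: comm_ring_1" where
  "odd_weight x n M = (if \<forall>i\<in>{1..2 * n}. odd i \<longrightarrow> i \<in> M then x ^ card {i. 2 * i \<in> M} else 0)"

text \<open>The indicator that a filling of \<open>n\<close> columns with match set \<open>M\<close> has matches at all positions.\<close>

definition full_weight :: "nat \<Rightarrow> nat set \<Rightarrow> 'b :: comm_ring_1" where
  "full_weight n M = (if {1..n - 1} \<subseteq> M then 1 else 0)"

text \<open>In the \<open>m\<close>-th term, the two weights are evaluated at the match sets of the first \<open>2 * m\<close> and of the
  last \<open>2 * (n - m)\<close> columns of a filling with match set \<open>M\<close>.\<close>

lemma odd_weight_expansion:
  fixes x :: "'b :: comm_ring_1"
  assumes M: "M \<subseteq> {1..2 * n - 1}" and n: "n \<ge> 1"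
  shows "odd_weight x n M = (\<Sum>m = 1..n. (x - 1) ^ (m - 1) *
    (full_weight (2 * m) (M \<inter> {1..2 * m - 1}) *
     odd_weight x (n - m) {i \<in> {1..2 * (n - m) - 1}. 2 * m + i \<in> M}))"
proof (cases "\<forall>i\<in>{1..2 * n}. odd i \<longrightarrow> i \<in> M")
  case True
  define S where "S = {i. 2 * i \<in> M}"
  have S: "S \<subseteq> {1..<n}"
  proof
    fix i assume "i \<in> S"
    then have "2 * i \<in> {1..2 * n - 1}"
      using M by (auto simp: S_def)
    then show "i \<in> {1..<n}"
      by auto
  qed
  have "odd_weight x n M = x ^ card S"
    using True by (simp add: odd_weight_def S_def)
  also have "\<dots> = (\<Sum>m = 1..n. (if {1..<m} \<subseteq> S
      then (x - 1) ^ (m - 1) * x ^ card {i. i \<ge> 1 \<and> m + i \<in> S} else 0))"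
    using S n by (rule power_card_expansion)
  also have "\<dots> = (\<Sum>m = 1..n. (x - 1) ^ (m - 1) *
    (full_weight (2 * m) (M \<inter> {1..2 * m - 1}) *
     odd_weight x (n - m) {i \<in> {1..2 * (n - m) - 1}. 2 * m + i \<in> M}))"
  proof (rule sum.cong[OF refl])
    fix m assume m: "m \<in> {1..n}"
    let ?R = "{i \<in> {1..2 * (n - m) - 1}. 2 * m + i \<in> M}"
    have "{1..2 * m - 1} \<subseteq> M \<longleftrightarrow> {1..<m} \<subseteq> S"
    proof
      assume "{1..2 * m - 1} \<subseteq> M"
      then show "{1..<m} \<subseteq> S"
        by (auto simp: S_def subset_eq)
    next
      assume sub: "{1..<m} \<subseteq> S"
      show "{1..2 * m - 1} \<subseteq> M"
      proof
        fix i assume i: "i \<in> {1..2 * m - 1}"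
        show "i \<in> M"
        proof (cases "even i")
          case True
          then obtain j where "i = 2 * j" by blast
          then show ?thesis
            using i sub by (auto simp: S_def subset_eq)
        next
          case False
          then show ?thesis
            using True i m by auto
        qed
      qed
    qed
    then have full: "full_weight (2 * m) (M \<inter> {1..2 * m - 1}) =
        (if {1..<m} \<subseteq> S then 1 else (0 :: 'b))"
      by (simp add: full_weight_def)
    have odd: "i \<in> ?R" if "i \<in> {1..2 * (n - m)}" "odd i" for i
    proof -
      have "i \<noteq> 2 * (n - m)"
        using that(2) by auto
      then show ?thesis
        using that True m by auto
    qed
    have "{i. 2 * i \<in> ?R} = {i. i \<ge> 1 \<and> m + i \<in> S}"
    proof (intro Collect_cong iffI)
      fix i assume "2 * i \<in> ?R"
      then show "i \<ge> 1 \<and> m + i \<in> S"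
        by (auto simp: S_def algebra_simps)
    next
      fix i assume i: "i \<ge> 1 \<and> m + i \<in> S"
      then have "m + i < n"
        using S by auto
      then show "2 * i \<in> ?R"
        using i by (auto simp: S_def algebra_simps)
    qed
    then have "odd_weight x (n - m) ?R = x ^ card {i. i \<ge> 1 \<and> m + i \<in> S}"
      unfolding odd_weight_def using odd by simp
    then show "(if {1..<m} \<subseteq> S then (x - 1) ^ (m - 1) * x ^ card {i. i \<ge> 1 \<and> m + i \<in> S} else 0) =
      (x - 1) ^ (m - 1) * (full_weight (2 * m) (M \<inter> {1..2 * m - 1}) * odd_weight x (n - m) ?R)"
      using full by simp
  qed
  finally show ?thesis .
next
  case False
  \<comment> \<open>An odd position without a match lies inside one of the two parts, since the cut is at an even
    position; hence every term vanishes.\<close>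
  then obtain j where j: "j \<in> {1..2 * n}" "odd j" "j \<notin> M"
    by blast
  have "full_weight (2 * m) (M \<inter> {1..2 * m - 1}) *
     odd_weight x (n - m) {i \<in> {1..2 * (n - m) - 1}. 2 * m + i \<in> M} = 0" if "m \<in> {1..n}" for m
  proof (cases "j < 2 * m")
    case True
    then have "j \<in> {1..2 * m - 1}"
      using j(1) by auto
    then show ?thesis
      using j by (auto simp: full_weight_def)
  next
    case lt: False
    have "j \<noteq> 2 * m"
      using j(2) by auto
    then have "j - 2 * m \<in> {1..2 * (n - m)}" "odd (j - 2 * m)" "2 * m + (j - 2 * m) \<notin> M"
      using lt j by auto
    then have "\<not> (\<forall>i\<in>{1..2 * (n - m)}. odd i \<longrightarrow>
        i \<in> {i \<in> {1..2 * (n - m) - 1}. 2 * m + i \<in> M})"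
      by blast
    then have "odd_weight x (n - m) {i \<in> {1..2 * (n - m) - 1}. 2 * m + i \<in> M} = 0"
      unfolding odd_weight_def by (rule if_not_P)
    then show ?thesis
      by simp
  qed
  moreover have "odd_weight x n M = 0"
    unfolding odd_weight_def using False by (rule if_not_P)
  ultimately show ?thesis
    by simp
qed

section \<open>The recurrence and the generating function\<close>

lemma sum_odd_match_fillings:
  "(\<Sum>F\<in>odd_match_fillings (2 * n) k \<Upsilon>. x ^ even_mch (2 * n) k \<Upsilon> F) =
   (\<Sum>F\<in>fillings (2 * n) k. odd_weight x n (match_set (2 * n) k \<Upsilon> F))"
  unfolding odd_match_fillings_def odd_weight_def even_mch_def
  by (rule sum.inter_filter) (simp add: fillings_eq_on_values finite_on_values)

lemma full_eq_sum: "of_nat (full n k \<Upsilon>) = (\<Sum>F\<in>fillings n k. full_weight n (match_set n k \<Upsilon> F))"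
proof -
  have "finite (fillings n k)"
    by (simp add: fillings_eq_on_values finite_on_values)
  then show ?thesis
    unfolding full_def full_weight_def by (simp add: sum.inter_filter[symmetric] subset_eq)
qed

lemma odd_match_recurrence:
  fixes x :: "'b :: comm_ring_1" and k :: nat and \<Upsilon> :: "(nat \<times> nat \<Rightarrow> nat) set"
  defines "A \<equiv> \<lambda>n. \<Sum>F\<in>odd_match_fillings (2 * n) k \<Upsilon>. x ^ even_mch (2 * n) k \<Upsilon> F"
  assumes "n \<ge> 1"
  shows "A n = (\<Sum>m = 1..n. of_nat ((2 * k * n) choose (2 * k * m)) *
    (of_nat (full (2 * m) k \<Upsilon>) * (x - 1) ^ (m - 1) * A (n - m)))"
proof -
  let ?M = "match_set (2 * n) k \<Upsilon>"
  have "A n = (\<Sum>F\<in>fillings (2 * n) k. \<Sum>m = 1..n. (x - 1) ^ (m - 1) *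
    (full_weight (2 * m) (?M F \<inter> {1..2 * m - 1}) *
     odd_weight x (n - m) {i \<in> {1..2 * (n - m) - 1}. 2 * m + i \<in> ?M F}))"
    unfolding A_def sum_odd_match_fillings
    using assms(2) by (intro sum.cong odd_weight_expansion) (auto simp: match_set_def)
  also have "\<dots> = (\<Sum>m = 1..n. (x - 1) ^ (m - 1) * (\<Sum>F\<in>fillings (2 * n) k.
    full_weight (2 * m) (?M F \<inter> {1..2 * m - 1}) *
     odd_weight x (n - m) {i \<in> {1..2 * (n - m) - 1}. 2 * m + i \<in> ?M F}))"
    unfolding sum_distrib_left by (rule sum.swap)
  also have "\<dots> = (\<Sum>m = 1..n. of_nat ((2 * k * n) choose (2 * k * m)) *
    (of_nat (full (2 * m) k \<Upsilon>) * (x - 1) ^ (m - 1) * A (n - m)))"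
  proof (rule sum.cong[OF refl])
    fix m assume "m \<in> {1..n}"
    then have n: "2 * n = 2 * m + 2 * (n - m)"
      by auto
    have "(\<Sum>F\<in>fillings (2 * n) k. full_weight (2 * m) (?M F \<inter> {1..2 * m - 1}) *
       odd_weight x (n - m) {i \<in> {1..2 * (n - m) - 1}. 2 * m + i \<in> ?M F}) =
      of_nat ((k * (2 * n)) choose (k * (2 * m))) * (of_nat (full (2 * m) k \<Upsilon>) * A (n - m))"
      unfolding n A_def sum_odd_match_fillings full_eq_sum by (rule sum_fillings_split)
    then show "(x - 1) ^ (m - 1) * (\<Sum>F\<in>fillings (2 * n) k.
        full_weight (2 * m) (?M F \<inter> {1..2 * m - 1}) *
        odd_weight x (n - m) {i \<in> {1..2 * (n - m) - 1}. 2 * m + i \<in> ?M F}) =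
      of_nat ((2 * k * n) choose (2 * k * m)) *
        (of_nat (full (2 * m) k \<Upsilon>) * (x - 1) ^ (m - 1) * A (n - m))"
      by (simp add: ac_simps)
  qed
  finally show ?thesis .
qed

text \<open>The empty array has exactly one filling.\<close>

lemma sum_odd_match_fillings_0:
  "(\<Sum>F\<in>odd_match_fillings 0 k \<Upsilon>. x ^ even_mch 0 k \<Upsilon> F) = (1 :: 'b :: comm_ring_1)"
proof -
  have "odd_match_fillings 0 k \<Upsilon> = {\<lambda>_. undefined}"
    by (auto simp: odd_match_fillings_def fillings_def cells_def bij_betw_def)
  then show ?thesis
    by (simp add: even_mch_def match_set_def)
qed

lemma smult_sum_right: "smult c (\<Sum>i\<in>I. p i) = (\<Sum>i\<in>I. smult c (p i))"
  by (induction I rule: infinite_finite_induct) (simp_all add: smult_add_right)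

text \<open>The recurrence says \<open>E\<^sub>a = E\<^sub>b * (1 + E\<^sub>a)\<close> for the even series \<open>E\<^sub>a\<close> and \<open>E\<^sub>b\<close> of the two
  sequences, i.e. \<open>(1 - E\<^sub>b) * (1 + E\<^sub>a) = 1\<close>.\<close>

lemma even_series_reciprocal:
  fixes a b :: "nat \<Rightarrow> 'b :: comm_ring_1"
  assumes a0: "a 0 = 1" and rec: "\<And>n. n \<ge> 1 \<Longrightarrow> a n = (\<Sum>m = 1..n. b m * a (n - m))"
  shows "1 + even_series a = fps_right_inverse (1 - even_series b) 1"
proof -
  let ?P = "1 + even_series a" and ?B = "even_series b"
  have P: "?P $ N = (if even N then a (N div 2) else 0)" for N
    using a0 by (auto simp: even_series_def elim!: evenE)
  have "(?B * ?P) $ N = even_series a $ N" for N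
  proof -
    have B: "?B $ i = (if i \<in> (*) 2 ` {1..N div 2} then b (i div 2) else 0)" if "i \<le> N" for i
      using that by (auto simp: even_series_def image_iff elim!: evenE)
    have "(?B * ?P) $ N = (\<Sum>i = 0..N. ?B $ i * ?P $ (N - i))"
      by (rule fps_mult_nth)
    also have "\<dots> = (\<Sum>i\<in>(*) 2 ` {1..N div 2}. ?B $ i * ?P $ (N - i))"
      using B by (intro sum.mono_neutral_right) auto
    also have "\<dots> = (\<Sum>m = 1..N div 2. ?B $ (2 * m) * ?P $ (N - 2 * m))"
      by (subst sum.reindex) (auto simp: inj_on_def)
    also have "\<dots> = (\<Sum>m = 1..N div 2. b m * (if even N then a (N div 2 - m) else 0))"
    proof (rule sum.cong[OF refl])
      fix m assume m: "m \<in> {1..N div 2}"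
      then have "even (N - 2 * m) \<longleftrightarrow> even N" "(N - 2 * m) div 2 = N div 2 - m"
        by auto
      moreover have "?B $ (2 * m) = b m"
        using m by (simp add: even_series_def)
      ultimately show "?B $ (2 * m) * ?P $ (N - 2 * m) =
          b m * (if even N then a (N div 2 - m) else 0)"
        unfolding P by simp
    qed
    also have "\<dots> = even_series a $ N"
    proof (cases "even N \<and> N > 0")
      case True
      then have "N div 2 \<ge> 1"
        by auto
      then show ?thesis
        using True rec[of "N div 2"] by (simp add: even_series_def)
    qed (auto simp: even_series_def)
    finally show ?thesis .
  qed
  then have "(1 - ?B) * ?P = 1"
    by (simp add: left_diff_distrib fps_eq_iff)
  moreover have "?P $ 0 = 1" "(1 - ?B) $ 0 = 1"
    by (simp_all add: even_series_def)
  ultimately show ?thesis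
    using fps_lr_inverse_unique_ring1(2)[of "1 - ?B" ?P] by simp
qed

(* Coefficients lie in rat poly, which has no division, so the reciprocal is written with
   fps_right_inverse, whose second argument is the inverse of the constant coefficient. *)
theorem theorem7:
  fixes k :: nat and \<Upsilon> :: "(nat \<times> nat \<Rightarrow> nat) set"
  assumes "k \<ge> 1" and "\<Upsilon> \<subseteq> fillings 2 k"
  defines "x \<equiv> [:0, 1:] :: rat poly"
  shows "1 + even_series (\<lambda>n. smult (1 / fact (2 * k * n))
             (\<Sum>F\<in>odd_match_fillings (2 * n) k \<Upsilon>. x ^ even_mch (2 * n) k \<Upsilon> F))
       = fps_right_inverse
           (1 - even_series (\<lambda>n. smult (of_nat (full (2 * n) k \<Upsilon>) / fact (2 * k * n))
             ((x - 1) ^ (n - 1)))) 1"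
proof (rule even_series_reciprocal)
  let ?A = "\<lambda>n. \<Sum>F\<in>odd_match_fillings (2 * n) k \<Upsilon>. x ^ even_mch (2 * n) k \<Upsilon> F"
  show "smult (1 / fact (2 * k * 0)) (?A 0) = 1"
    using sum_odd_match_fillings_0[of x k \<Upsilon>] by simp
  fix n :: nat assume n: "n \<ge> 1"
  have "smult (1 / fact (2 * k * n)) (?A n) =
    (\<Sum>m = 1..n. smult (1 / fact (2 * k * n)) (of_nat ((2 * k * n) choose (2 * k * m)) *
      (of_nat (full (2 * m) k \<Upsilon>) * (x - 1) ^ (m - 1) * ?A (n - m))))"
    unfolding odd_match_recurrence[OF n] by (rule smult_sum_right)
  also have "\<dots> = (\<Sum>m = 1..n. smult (of_nat (full (2 * m) k \<Upsilon>) / fact (2 * k * m))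
      ((x - 1) ^ (m - 1)) * smult (1 / fact (2 * k * (n - m))) (?A (n - m)))"
  proof (rule sum.cong[OF refl])
    fix m assume m: "m \<in> {1..n}"
    then have "2 * k * m \<le> 2 * k * n"
      by simp
    then have "of_nat ((2 * k * n) choose (2 * k * m)) =
        (fact (2 * k * n) / (fact (2 * k * m) * fact (2 * k * (n - m))) :: rat)"
      by (simp add: binomial_fact diff_mult_distrib2)
    then show "smult (1 / fact (2 * k * n)) (of_nat ((2 * k * n) choose (2 * k * m)) *
        (of_nat (full (2 * m) k \<Upsilon>) * (x - 1) ^ (m - 1) * ?A (n - m))) =
      smult (of_nat (full (2 * m) k \<Upsilon>) / fact (2 * k * m))
        ((x - 1) ^ (m - 1)) * smult (1 / fact (2 * k * (n - m))) (?A (n - m))"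
      by (simp add: of_nat_poly mult_ac)
  qed
  finally show "smult (1 / fact (2 * k * n)) (?A n) =
    (\<Sum>m = 1..n. smult (of_nat (full (2 * m) k \<Upsilon>) / fact (2 * k * m))
      ((x - 1) ^ (m - 1)) * smult (1 / fact (2 * k * (n - m))) (?A (n - m)))" .
qed

end
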